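(* Let $G=(V,E)$ be a finite digraph with minimum out-degree at least $d$ and maximum in-degree at most $e^{\frac{d-1}{16}-1}/d$. Then for every pair of distinct vertices $v_1,v_2\in V$ there exists an $r$-friendly partition of $G$ separating $v_1$ and $v_2$, where $r=\frac{d-1}{4}+1$.
   Context: Digraphs have no loops and no parallel arcs in the same direction. For $r>0$, an $r$-friendly partition of $G=(V,E)$ is a partition $\{V_1,V_2\}$ of $V$ into two nonempty sets such that every vertex has at least $r$ out-neighbors in its own part; it separates $v_1,v_2$ if they lie in different parts. $e$ is Euler's number. *)

theory Defs
  imports Complex_Main "HOL-Library.Disjoint_Sets" "Graph_Theory.Digraph"
begin

(* Min and Max are unspecified on the empty set, so these two are meaningful only for
   finite digraphs with at least one vertex. *)

definition min_out_degree :: "('a, 'b) pre_digraph \<Rightarrow> nat" where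
  "min_out_degree G = Min (out_degree G ` verts G)"

definition max_in_degree :: "('a, 'b) pre_digraph \<Rightarrow> nat" where
  "max_in_degree G = Max (in_degree G ` verts G)"

definition out_neighbors :: "('a, 'b) pre_digraph \<Rightarrow> 'a \<Rightarrow> 'a set" where
  "out_neighbors G v = {w. v \<rightarrow>\<^bsub>G\<^esub> w}"

(* partition_on already requires the parts to be nonempty; r is intended to be positive. *)
definition friendly_partition :: "('a, 'b) pre_digraph \<Rightarrow> real \<Rightarrow> 'a set set \<Rightarrow> bool" where
  "friendly_partition G r P \<longleftrightarrow>
     partition_on (verts G) P \<and> card P = 2 \<and>
     (\<forall>A\<in>P. \<forall>v\<in>A. r \<le> real (card (out_neighbors G v \<inter> A)))"

definition separates :: "'a set set \<Rightarrow> 'a \<Rightarrow> 'a \<Rightarrow> bool" where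
  "separates P u v \<longleftrightarrow> (\<exists>A\<in>P. \<exists>B\<in>P. A \<noteq> B \<and> u \<in> A \<and> v \<in> B)"

end

theory Submission
  imports Defs
begin

text \<open>
  Put \<open>v1\<close> and \<open>v2\<close> in different parts and distribute the remaining vertices uniformly at
  random. For every vertex \<open>v\<close> fix a set \<open>T v\<close> of \<open>d - 2\<close> out-neighbours other than \<open>v1\<close> and
  \<open>v2\<close>; the bad event at \<open>v\<close> is that fewer than \<open>(d - 1)/4 + 1\<close> members of \<open>T v\<close> are in the part
  of \<open>v\<close>. Even after fixing the parts of all vertices outside \<open>T v\<close>, in particular of \<open>v\<close> itself,
  this has exponentially small probability. Hence the bad event at \<open>v\<close> only has to be regarded as
  dependent on those at vertices \<open>u\<close> for which \<open>{u} \<union> T u\<close> meets \<open>T v\<close>, of which the in-degree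
  bound leaves at most \<open>d (\<Delta> + 1)\<close>, and the Lovasz local lemma applies. The hypothesis on the
  in-degree forces \<open>d > 65\<close>, and this leaves enough room to absorb all constants.
\<close>

section \<open>A counting form of the local lemma\<close>

text \<open>Removing the events of \<open>N i\<close> from the condition at most doubles the set of
  surviving outcomes, so the bound \<open>p\<close> given by \<open>indep\<close> degrades to
  \<open>2 * p\<close>. Comparing cardinalities instead of conditional probabilities avoids dividing
  by a count that might be zero.\<close>

lemma lovasz_local_card_step:
  fixes \<Omega> :: "'s set" and bad :: "'i \<Rightarrow> 's set" and p D :: real
  assumes fin: "finite \<Omega>" "finite I"
    and p: "0 \<le> p" "4 * p * D \<le> 1"
    and N: "\<And>i. i \<in> I \<Longrightarrow> real (card (I \<inter> N i)) \<le> D"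
    and indep: "\<And>i S. i \<in> I \<Longrightarrow> S \<subseteq> I - N i \<Longrightarrow>
      real (card (\<Omega> \<inter> bad i - \<Union>(bad ` S))) \<le> p * real (card (\<Omega> - \<Union>(bad ` S)))"
    and "S \<subseteq> I" "i \<in> I"
  shows "real (card (\<Omega> \<inter> bad i - \<Union>(bad ` S))) \<le> 2 * p * real (card (\<Omega> - \<Union>(bad ` S)))"
  using \<open>S \<subseteq> I\<close> \<open>i \<in> I\<close>
proof (induction "card S" arbitrary: S i rule: less_induct)
  case less
  define R where "R = S - N i"
  have finS: "finite S" using less.prems fin finite_subset by blast
  have R: "R \<subseteq> I - N i" using less.prems by (auto simp: R_def)
  let ?av = "\<lambda>S. \<Omega> - \<Union>(bad ` S)"
  have finav: "finite (?av S)" for S using fin by auto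
  have step: "real (card (\<Omega> \<inter> bad j - \<Union>(bad ` R))) \<le> 2 * p * real (card (?av R))"
    if "j \<in> S \<inter> N i" for j
  proof -
    have "R \<subset> S" using that by (auto simp: R_def)
    then have "card R < card S" using finS psubset_card_mono by blast
    then show ?thesis using less.hyps[of R j] that R less.prems by auto
  qed
  \<comment> \<open>An outcome that avoids \<open>R\<close> but not \<open>S\<close> lies in some
    \<open>bad j\<close> with \<open>j \<in> S \<inter> N i\<close>. By induction each such set
    takes at most a share \<open>2 * p\<close> of \<open>?av R\<close>, so together at most one
    half, as \<open>4 * p * D \<le> 1\<close>.\<close>
  have sub: "?av R \<subseteq> ?av S \<union> (\<Union>j\<in>S \<inter> N i. \<Omega> \<inter> bad j - \<Union>(bad ` R))"
    by (auto simp: R_def)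
  have "card (?av R) \<le> card (?av S \<union> (\<Union>j\<in>S \<inter> N i. \<Omega> \<inter> bad j - \<Union>(bad ` R)))"
    by (rule card_mono[OF _ sub]) (use fin finS in auto)
  also have "\<dots> \<le> card (?av S) + card (\<Union>j\<in>S \<inter> N i. \<Omega> \<inter> bad j - \<Union>(bad ` R))"
    by (rule card_Un_le)
  also have "\<dots> \<le> card (?av S) + (\<Sum>j\<in>S \<inter> N i. card (\<Omega> \<inter> bad j - \<Union>(bad ` R)))"
    by (intro add_left_mono card_UN_le) (use finS in auto)
  finally have "real (card (?av R))
      \<le> real (card (?av S)) + (\<Sum>j\<in>S \<inter> N i. real (card (\<Omega> \<inter> bad j - \<Union>(bad ` R))))"
    unfolding of_nat_sum[symmetric] of_nat_add[symmetric] of_nat_le_iff .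
  also have "(\<Sum>j\<in>S \<inter> N i. real (card (\<Omega> \<inter> bad j - \<Union>(bad ` R))))
      \<le> real (card (S \<inter> N i)) * (2 * p * real (card (?av R)))"
    using sum_mono[of "S \<inter> N i", OF step] by simp
  also have "\<dots> \<le> D * (2 * p * real (card (?av R)))"
  proof (rule mult_right_mono)
    have "card (S \<inter> N i) \<le> card (I \<inter> N i)"
      using less.prems fin by (intro card_mono) auto
    then show "real (card (S \<inter> N i)) \<le> D" using N[OF less.prems(2)] by linarith
  qed (use p in auto)
  also have "\<dots> = (4 * p * D) * (real (card (?av R)) / 2)" by simp
  also have "\<dots> \<le> 1 * (real (card (?av R)) / 2)"
    by (rule mult_right_mono) (use p in auto)
  finally have half: "real (card (?av R)) \<le> 2 * real (card (?av S))" by simp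
  have "card (\<Omega> \<inter> bad i - \<Union>(bad ` S)) \<le> card (\<Omega> \<inter> bad i - \<Union>(bad ` R))"
    by (rule card_mono) (use fin in \<open>auto simp: R_def\<close>)
  then have "real (card (\<Omega> \<inter> bad i - \<Union>(bad ` S))) \<le> p * real (card (?av R))"
    using indep[OF less.prems(2) R] by linarith
  also have "\<dots> \<le> p * (2 * real (card (?av S)))"
    by (rule mult_left_mono[OF half]) (use p in auto)
  finally show ?case by simp
qed

text \<open>Events are avoided one after another: each new one removes at most the fraction
  \<open>2 * p\<close> of the current survivors, and \<open>1 \<le> D\<close> forces
  \<open>2 * p < 1\<close>, so some survive.\<close>

lemma lovasz_local_card:
  fixes \<Omega> :: "'s set" and bad :: "'i \<Rightarrow> 's set" and p D :: real
  assumes fin: "finite \<Omega>" "finite I" and "\<Omega> \<noteq> {}"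
    and p: "0 \<le> p" "4 * p * D \<le> 1" "1 \<le> D"
    and N: "\<And>i. i \<in> I \<Longrightarrow> real (card (I \<inter> N i)) \<le> D"
    and indep: "\<And>i S. i \<in> I \<Longrightarrow> S \<subseteq> I - N i \<Longrightarrow>
      real (card (\<Omega> \<inter> bad i - \<Union>(bad ` S))) \<le> p * real (card (\<Omega> - \<Union>(bad ` S)))"
  shows "\<Omega> - \<Union>(bad ` I) \<noteq> {}"
proof -
  have "4 * p * 1 \<le> 4 * p * D" using p by (intro mult_left_mono) auto
  then have p4: "2 * p < 1" using p by linarith
  have "\<Omega> - \<Union>(bad ` S) \<noteq> {}" if "S \<subseteq> I" for S
    using finite_subset[OF that fin(2)] that
  proof (induction S rule: finite_induct)
    case empty
    then show ?case using \<open>\<Omega> \<noteq> {}\<close> by simp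
  next
    case (insert i S)
    let ?A = "\<Omega> - \<Union>(bad ` S)"
    have "real (card (\<Omega> \<inter> bad i - \<Union>(bad ` S))) \<le> 2 * p * real (card ?A)"
      by (rule lovasz_local_card_step[OF fin p(1,2) N indep]) (use insert in auto)
    also have "\<dots> < 1 * real (card ?A)"
    proof (rule mult_strict_right_mono[OF p4])
      show "0 < real (card ?A)" using insert fin by (simp add: card_gt_0_iff)
    qed
    finally have "\<Omega> \<inter> bad i - \<Union>(bad ` S) \<noteq> ?A" by auto
    then show ?case by auto
  qed
  then show ?thesis by blast
qed

section \<open>Random subsets\<close>

text \<open>Condition on \<open>X - T\<close>: \<open>Q\<close> is constant on each fibre of sets
  \<open>Z \<union> Y\<close> with \<open>Y \<subseteq> T\<close>, and \<open>R\<close> holds on at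
  most a fraction \<open>p\<close> of every fibre. This supplies the independence hypothesis of the
  local lemma.\<close>

lemma card_Pow_split_le:
  fixes p :: real
  assumes "finite W" "T \<subseteq> W"
    and Q: "\<And>X. X \<subseteq> W \<Longrightarrow> Q X \<longleftrightarrow> Q (X - T)"
    and R: "\<And>Z. Z \<subseteq> W - T \<Longrightarrow> real (card {Y. Y \<subseteq> T \<and> R (Z \<union> Y)}) \<le> p * 2 ^ card T"
  shows "real (card {X. X \<subseteq> W \<and> Q X \<and> R X}) \<le> p * real (card {X. X \<subseteq> W \<and> Q X})"
proof -
  have finT: "finite T" using assms finite_subset by blast
  let ?Z = "{Z. Z \<subseteq> W - T \<and> Q Z}"
  have finZ: "finite ?Z" using assms by (auto intro: finite_subset[of _ "Pow W"])
  \<comment> \<open>Kept general in \<open>P\<close>: it is applied to \<open>R\<close> and, for the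
    total, to the constant \<open>True\<close>.\<close>
  have count: "card {X. X \<subseteq> W \<and> Q X \<and> P X} = (\<Sum>Z\<in>?Z. card {Y. Y \<subseteq> T \<and> P (Z \<union> Y)})" for P
  proof -
    have "bij_betw (\<lambda>(Z, Y). Z \<union> Y) (SIGMA Z:?Z. {Y. Y \<subseteq> T \<and> P (Z \<union> Y)}) {X. X \<subseteq> W \<and> Q X \<and> P X}"
    proof (rule bij_betw_byWitness[where f' = "\<lambda>X. (X - T, X \<inter> T)"], goal_cases)
      case 1
      then show ?case by auto
    next
      case 2
      then show ?case by (auto simp: Un_Diff_Int Diff_Int_distrib Un_commute)
    next
      case 3
      have "Q (Z \<union> Y)" if "Z \<subseteq> W - T" "Q Z" "Y \<subseteq> T" for Z Y
      proof -
        have "Z \<union> Y - T = Z" using that by auto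
        then show ?thesis using Q[of "Z \<union> Y"] that assms(2) by auto
      qed
      then show ?case using assms(2) by auto
    next
      case 4
      have "X - T \<union> X \<inter> T = X" for X :: "'a set" by auto
      then show ?case using Q by auto
    qed
    then have "card {X. X \<subseteq> W \<and> Q X \<and> P X} = card (SIGMA Z:?Z. {Y. Y \<subseteq> T \<and> P (Z \<union> Y)})"
      by (rule bij_betw_same_card[symmetric])
    also have "\<dots> = (\<Sum>Z\<in>?Z. card {Y. Y \<subseteq> T \<and> P (Z \<union> Y)})"
      using finZ finT by (intro card_SigmaI) (auto intro: finite_subset[of _ "Pow T"])
    finally show ?thesis .
  qed
  have all: "card {Y. Y \<subseteq> T} = 2 ^ card T" using card_Pow[OF finT] by (simp add: Pow_def)
  have "real (card {X. X \<subseteq> W \<and> Q X \<and> R X}) = (\<Sum>Z\<in>?Z. real (card {Y. Y \<subseteq> T \<and> R (Z \<union> Y)}))"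
    using count[of R] by simp
  also have "\<dots> \<le> (\<Sum>Z\<in>?Z. p * 2 ^ card T)"
    by (rule sum_mono) (use R in auto)
  also have "\<dots> = p * real (card {X. X \<subseteq> W \<and> Q X})"
    using count[of "\<lambda>_. True"] all by simp
  finally show ?thesis .
qed

text \<open>The Chernoff argument with the exponential moment of \<open>(1/2) ^ card Y\<close>.\<close>

lemma card_small_subsets_le:
  fixes r :: real
  assumes "finite T"
  shows "real (card {Y. Y \<subseteq> T \<and> real (card Y) < r}) \<le> ((3/4) ^ card T * 2 powr r) * 2 ^ card T"
proof -
  \<comment> \<open>Expansion of the product of \<open>1/2 + 1\<close> over \<open>T\<close>:
    choosing \<open>1/2\<close> exactly on \<open>Y\<close> contributes
    \<open>(1/2) ^ card Y\<close>.\<close>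
  have moment: "(\<Sum>Y\<in>Pow T. (1/2::real) ^ card Y) = (3/2) ^ card T"
    using prod_add[OF assms, of "\<lambda>_. 1/2::real" "\<lambda>_. 1"] by simp
  let ?S = "{Y. Y \<subseteq> T \<and> real (card Y) < r}"
  have "real (card ?S) * 2 powr (- r) = (\<Sum>Y\<in>?S. 2 powr (- r))" by simp
  also have "\<dots> \<le> (\<Sum>Y\<in>?S. (1/2::real) ^ card Y)"
  proof (rule sum_mono)
    fix Y assume "Y \<in> ?S"
    then have "2 powr (- r) \<le> 2 powr (- real (card Y))" by simp
    also have "\<dots> = (1/2) ^ card Y"
      by (simp add: powr_minus powr_realpow power_one_over field_simps)
    finally show "2 powr (- r) \<le> (1/2) ^ card Y" .
  qed
  also have "\<dots> \<le> (\<Sum>Y\<in>Pow T. (1/2::real) ^ card Y)"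
    by (rule sum_mono2) (use assms in auto)
  finally have "real (card ?S) * 2 powr (- r) \<le> (3/2) ^ card T" using moment by simp
  then have "real (card ?S) \<le> (3/2) ^ card T * 2 powr r"
    by (simp add: powr_minus field_simps)
  also have "(3/2::real) ^ card T = (3/4) ^ card T * 2 ^ card T"
    by (simp flip: power_mult_distrib)
  finally show ?thesis by (simp add: mult_ac)
qed

text \<open>Complementation within \<open>T\<close> is an involution that swaps the two conditions.
  This version serves the vertices outside \<open>insert v1 X\<close>, whose part contains
  \<open>T v - X\<close>.\<close>

lemma card_small_complements_le:
  fixes r :: real
  assumes "finite T"
  shows "real (card {Y. Y \<subseteq> T \<and> real (card (T - Y)) < r}) \<le> ((3/4) ^ card T * 2 powr r) * 2 ^ card T"
proof -
  have "bij_betw (\<lambda>Y. T - Y) {Y. Y \<subseteq> T \<and> real (card (T - Y)) < r} {Y. Y \<subseteq> T \<and> real (card Y) < r}"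
    by (rule bij_betw_byWitness[where f' = "\<lambda>Y. T - Y"]) (auto simp: double_diff)
  then show ?thesis using card_small_subsets_le[OF assms, of r] by (simp add: bij_betw_same_card)
qed

section \<open>Numerical estimates\<close>

text \<open>The exponent is -1 at \<open>d = 1\<close> and at most 0, 1, 3 up to
  \<open>d = 17, 33, 65\<close>; with \<open>exp 1 \<le> 3\<close> the right side stays below
  \<open>d\<close> on each of these ranges.\<close>

lemma degree_lower_bound:
  fixes d :: nat
  assumes "d \<ge> 1" "real d \<le> exp ((real d - 1) / 16 - 1)"
  shows "d > 65"
proof (rule ccontr)
  assume "\<not> d > 65"
  then have d: "d \<le> 65" by simp
  have e1: "exp (1::real) \<le> 3" by (rule exp_le)
  consider "d = 1" | "2 \<le> d" "d \<le> 17" | "17 < d" "d \<le> 33" | "33 < d" using assms by linarith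
  then show False
  proof cases
    case 1
    have "exp (-1 :: real) < 1" by simp
    then show ?thesis using 1 assms by simp
  next
    case 2
    then have "exp ((real d - 1) / 16 - 1) \<le> 1" by simp
    then show ?thesis using 2 assms by linarith
  next
    case 3
    then have "exp ((real d - 1) / 16 - 1) \<le> exp 1" by simp
    then show ?thesis using 3 assms e1 by linarith
  next
    case 4
    then have "exp ((real d - 1) / 16 - 1) \<le> exp 3" using d by simp
    also have "exp (3::real) = exp 1 ^ 3" by (simp flip: exp_of_nat_mult)
    also have "\<dots> \<le> 3 ^ 3" using e1 by (intro power_mono) auto
    finally show ?thesis using 4 assms by simp
  qed
qed

text \<open>The 8 is what the local lemma will need: 4 for its own constant and 2 from
  \<open>\<Delta> + 1 \<le> 2 * \<Delta>\<close>. Since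
  \<open>(3/4)^4 * 2 = 81/128 < exp (-1/4)\<close>, there is an exponential surplus that absorbs the
  constants.\<close>

lemma failure_probability_bound:
  fixes d :: nat
  assumes "d > 65"
  shows "(3/4) ^ (d - 2) * 2 powr ((real d - 1) / 4 + 1) \<le> exp (1 - (real d - 1) / 16) / 8"
proof -
  define m where "m = real d - 1"
  have m: "m \<ge> 64" using assms by (simp add: m_def)
  have "(3/4::real) ^ (d - 2) = (3/4) powr (m - 1)"
    using assms by (subst powr_realpow[symmetric]) (auto simp: m_def of_nat_diff)
  also have "\<dots> = (4/3) * (3/4) powr m" by (simp add: powr_diff)
  also have "(3/4::real) powr m = ((3/4) powr 4) powr (m/4)" by (simp only: powr_powr) simp
  also have "(3/4::real) powr 4 = 81/256" by (simp add: power_divide)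
  finally have a: "(3/4::real) ^ (d - 2) = (4/3) * (81/256) powr (m/4)" .
  have b: "2 powr (m/4 + 1) = 2 * 2 powr (m/4)" by (simp add: powr_add)
  have "(3/4) ^ (d - 2) * 2 powr (m/4 + 1) = (8/3) * ((81/256) powr (m/4) * 2 powr (m/4))"
    by (simp add: a b)
  also have "(81/256::real) powr (m/4) * 2 powr (m/4) = (81/128) powr (m/4)"
    by (simp flip: powr_mult)
  \<comment> \<open>The lower bound \<open>3/4\<close> for \<open>exp (-1/4)\<close> leaves exactly
    the factor \<open>27/32\<close>, as \<open>81/128 = 3/4 * 27/32\<close>.\<close>
  also have "(81/128::real) powr (m/4) \<le> (exp (-1/4) * (27/32)) powr (m/4)"
  proof (rule powr_mono2)
    have "3/4 \<le> exp (-1/4::real)" using exp_ge_add_one_self[of "-1/4"] by simp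
    then show "81/128 \<le> exp (-1/4::real) * (27/32)" by simp
  qed (use m in auto)
  also have "\<dots> = exp (- m / 16) * (27/32) powr (m/4)"
    by (subst powr_mult) (auto simp: exp_powr_real)
  \<comment> \<open>Here \<open>d > 65\<close> enters through \<open>m/4 \<ge> 16\<close>; then
    \<open>(27/32)^16 \<le> 3/32\<close> brings the factor \<open>8/3\<close> down to
    \<open>1/4\<close>.\<close>
  also have "\<dots> \<le> exp (- m / 16) * (27/32) powr 16"
    by (intro mult_left_mono powr_mono') (use m in auto)
  also have "(27/32::real) powr 16 = (27/32) ^ 16" by simp
  also have "(27/32::real) ^ 16 \<le> (3/32) * 1" by (simp add: power_divide field_simps)
  finally have "(3/4) ^ (d - 2) * 2 powr (m/4 + 1) \<le> exp (- m / 16) / 4" by simp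
  also have "\<dots> \<le> exp (- m / 16) * (exp 1 / 8)"
    using exp_ge_add_one_self[of 1] by simp
  also have "\<dots> = exp (1 - m / 16) / 8" by (simp flip: exp_add)
  finally show ?thesis by (simp add: m_def)
qed

section \<open>Degrees\<close>

text \<open>Without parallel arcs, \<open>head\<close> is injective on the arcs leaving
  \<open>v\<close>.\<close>

lemma (in digraph) card_out_neighbors: "card (out_neighbors G v) = out_degree G v"
proof -
  have "out_neighbors G v = head G ` out_arcs G v"
    by (auto simp: out_neighbors_def out_arcs_def arcs_ends_def arc_to_ends_def)
  moreover have "inj_on (head G) (out_arcs G v)"
    using no_multi_arcs by (auto simp: inj_on_def arc_to_ends_def)
  ultimately show ?thesis by (simp add: out_degree_def card_image)
qed

lemma (in fin_digraph) card_in_neighbors_le: "card {u. u \<rightarrow>\<^bsub>G\<^esub> w} \<le> in_degree G w"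
proof -
  have "{u. u \<rightarrow>\<^bsub>G\<^esub> w} = tail G ` in_arcs G w"
    by (auto simp: in_arcs_def arcs_ends_def arc_to_ends_def)
  then show ?thesis using card_image_le[OF finite_in_arcs, of "tail G" w] by (simp add: in_degree_def)
qed

lemma (in fin_digraph) in_neighbors_finite: "finite {u. u \<rightarrow>\<^bsub>G\<^esub> w}"
  by (rule finite_subset[OF _ finite_verts]) (auto dest: adj_in_verts)

section \<open>The separating partition\<close>

theorem theorem1p11:
  fixes G :: "('a, 'b) pre_digraph" and d :: nat
  assumes "digraph G"
    and "d \<ge> 1"
    and "min_out_degree G \<ge> d"
    and "real (max_in_degree G) \<le> exp ((real d - 1) / 16 - 1) / real d"
  shows "\<forall>v1\<in>verts G. \<forall>v2\<in>verts G. v1 \<noteq> v2 \<longrightarrow>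
           (\<exists>P. friendly_partition G ((real d - 1) / 4 + 1) P \<and> separates P v1 v2)"
proof (intro ballI impI)
  fix v1 v2
  assume v12: "v1 \<in> verts G" "v2 \<in> verts G" "v1 \<noteq> v2"
  interpret digraph G by fact
  define \<Delta> where "\<Delta> = max_in_degree G"
  define r where "r = (real d - 1) / 4 + 1"
  have outdeg: "card (out_neighbors G v) \<ge> d" if "v \<in> verts G" for v
  proof -
    have "min_out_degree G \<le> out_degree G v"
      using that by (auto simp: min_out_degree_def)
    then show ?thesis using assms(3) card_out_neighbors by simp
  qed
  have indeg: "card {u. u \<rightarrow>\<^bsub>G\<^esub> w} \<le> \<Delta>" if "w \<in> verts G" for w
  proof -
    have "in_degree G w \<le> \<Delta>" using that by (auto simp: max_in_degree_def \<Delta>_def)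
    then show ?thesis using card_in_neighbors_le[of w] by simp
  qed
  have out_sub: "out_neighbors G v \<subseteq> verts G" for v
    by (auto simp: out_neighbors_def dest: adj_in_verts)
  then have finout: "finite (out_neighbors G v)" for v
    using finite_subset finite_verts by blast
  \<comment> \<open>An out-neighbour of \<open>v1\<close> has an in-neighbour. With
    \<open>\<Delta> \<ge> 1\<close> the in-degree hypothesis bounds \<open>d\<close> itself by the
    exponential, whence \<open>d > 65\<close>.\<close>
  have \<Delta>1: "\<Delta> \<ge> 1"
  proof -
    have "out_neighbors G v1 \<noteq> {}" using outdeg[OF v12(1)] assms(2) by auto
    then obtain w where w: "v1 \<rightarrow>\<^bsub>G\<^esub> w" by (auto simp: out_neighbors_def)
    then have "card {u. u \<rightarrow>\<^bsub>G\<^esub> w} > 0" using in_neighbors_finite by (auto simp: card_gt_0_iff)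
    then show ?thesis using indeg[of w] adj_in_verts(2)[OF w] by linarith
  qed
  have \<Delta>d: "real d * real \<Delta> \<le> exp ((real d - 1) / 16 - 1)"
    using assms(2,4) by (simp add: \<Delta>_def field_simps)
  have "real d * 1 \<le> real d * real \<Delta>" using \<Delta>1 by (intro mult_left_mono) auto
  then have d65: "d > 65" using degree_lower_bound[OF assms(2)] \<Delta>d by linarith

  define W where "W = verts G - {v1, v2}"
  have finW: "finite W" by (simp add: W_def)
  have "\<exists>T. T \<subseteq> out_neighbors G v \<inter> W \<and> card T = d - 2" if "v \<in> verts G" for v
  proof -
    have "out_neighbors G v \<inter> W = out_neighbors G v - {v1, v2}" using out_sub by (auto simp: W_def)
    moreover have "card (out_neighbors G v) - card {v1, v2} \<le> card (out_neighbors G v - {v1, v2})"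
      by (rule diff_card_le_card_Diff) simp
    moreover have "card {v1, v2} = 2" using v12 by simp
    ultimately have "d - 2 \<le> card (out_neighbors G v \<inter> W)" using outdeg[OF that] by simp
    then show ?thesis by (metis obtain_subset_with_card_n)
  qed
  then obtain T where T: "\<And>v. v \<in> verts G \<Longrightarrow> T v \<subseteq> out_neighbors G v \<inter> W"
    and cardT: "\<And>v. v \<in> verts G \<Longrightarrow> card (T v) = d - 2" by metis
  have finT: "finite (T v)" if "v \<in> verts G" for v
    using T[OF that] finW finite_subset by blast
  have TW: "T v \<subseteq> W" if "v \<in> verts G" for v using T[OF that] by blast
  \<comment> \<open>By the absence of loops, redistributing \<open>T v\<close> cannot move
    \<open>v\<close> itself to the other part.\<close>
  have self: "v \<notin> T v" if "v \<in> verts G" for v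
    using T[OF that] adj_not_same by (auto simp: out_neighbors_def)

  text \<open>A subset \<open>X\<close> of \<open>W\<close> encodes the partition into \<open>insert v1 X\<close> and its complement.\<close>
  define own where "own X v = (if v \<in> insert v1 X then T v \<inter> X else T v - X)" for X v
  define bad where "bad v = {X. real (card (own X v)) < r}" for v
  \<comment> \<open>\<open>own X u\<close> depends on \<open>X\<close> only within
    \<open>insert u (T u)\<close>, so \<open>N v\<close> collects the events that changes inside
    \<open>T v\<close> may affect. The relation need not be symmetric.\<close>
  define N where "N v = {u \<in> verts G. insert u (T u) \<inter> T v \<noteq> {}}" for v
  define D where "D = real d * (real \<Delta> + 1)"
  define p where "p = (3/4) ^ (d - 2) * 2 powr r"

  have "Pow W - \<Union>(bad ` verts G) \<noteq> {}"
  proof (rule lovasz_local_card[where p = p and D = D and N = N])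
    show "finite (Pow W)" "finite (verts G)" "Pow W \<noteq> {}" using finW by auto
    show "0 \<le> p" by (simp add: p_def)
    have "1 * 1 \<le> real d * (real \<Delta> + 1)" using assms(2) by (intro mult_mono) auto
    then show "1 \<le> D" by (simp add: D_def)
    have "D \<le> real d * (2 * real \<Delta>)" unfolding D_def using \<Delta>1 by (intro mult_left_mono) auto
    then have "D \<le> 2 * exp ((real d - 1) / 16 - 1)" using \<Delta>d by simp
    moreover have "p \<le> exp (1 - (real d - 1) / 16) / 8"
      using failure_probability_bound[OF d65] by (simp add: p_def r_def)
    ultimately have "p * D \<le> (exp (1 - (real d - 1) / 16) / 8) * (2 * exp ((real d - 1) / 16 - 1))"
      using \<open>1 \<le> D\<close> by (intro mult_mono) auto
    also have "\<dots> = 1/4" by (simp flip: exp_add)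
    finally show "4 * p * D \<le> 1" by simp
  next
    fix v assume v: "v \<in> verts G"
    \<comment> \<open>Either \<open>u\<close> itself lies in \<open>T v\<close>, or
      \<open>T u\<close> meets \<open>T v\<close>, and then \<open>u\<close> is an in-neighbour of a
      member of \<open>T v\<close>.\<close>
    have "verts G \<inter> N v \<subseteq> T v \<union> (\<Union>w\<in>T v. {u. u \<rightarrow>\<^bsub>G\<^esub> w})"
      using T by (auto simp: N_def out_neighbors_def)
    then have "card (verts G \<inter> N v) \<le> card (T v \<union> (\<Union>w\<in>T v. {u. u \<rightarrow>\<^bsub>G\<^esub> w}))"
      by (rule card_mono[rotated]) (use finT[OF v] in_neighbors_finite in auto)
    also have "\<dots> \<le> card (T v) + card (\<Union>w\<in>T v. {u. u \<rightarrow>\<^bsub>G\<^esub> w})" by (rule card_Un_le)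
    also have "\<dots> \<le> card (T v) + (\<Sum>w\<in>T v. card {u. u \<rightarrow>\<^bsub>G\<^esub> w})"
      using card_UN_le[OF finT[OF v]] by simp
    also have "\<dots> \<le> card (T v) + (\<Sum>w\<in>T v. \<Delta>)"
      using indeg TW[OF v] by (intro add_left_mono sum_mono) (auto simp: W_def)
    also have "\<dots> = (d - 2) * (\<Delta> + 1)" using cardT[OF v] by simp
    also have "\<dots> \<le> d * (\<Delta> + 1)" by (rule mult_right_mono) auto
    finally show "real (card (verts G \<inter> N v)) \<le> D"
      unfolding D_def by (metis of_nat_1 of_nat_add of_nat_le_iff of_nat_mult)
  next
    fix v S assume v: "v \<in> verts G" and S: "S \<subseteq> verts G - N v"
    let ?Q = "\<lambda>X. \<forall>u\<in>S. X \<notin> bad u"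
    have "real (card {X. X \<subseteq> W \<and> ?Q X \<and> X \<in> bad v}) \<le> p * real (card {X. X \<subseteq> W \<and> ?Q X})"
    proof (rule card_Pow_split_le[OF finW TW[OF v]])
      fix X assume "X \<subseteq> W"
      \<comment> \<open>Since \<open>u \<notin> N v\<close>, deleting \<open>T v\<close> from
        \<open>X\<close> changes neither the side of \<open>u\<close> nor the sides of the members
        of \<open>T u\<close>.\<close>
      have "own (X - T v) u = own X u" if "u \<in> S" for u
        using that S by (auto simp: own_def N_def)
      then show "?Q X \<longleftrightarrow> ?Q (X - T v)" by (simp add: bad_def)
    next
      fix Z assume Z: "Z \<subseteq> W - T v"
      show "real (card {Y. Y \<subseteq> T v \<and> Z \<union> Y \<in> bad v}) \<le> p * 2 ^ card (T v)"
      proof (cases "v \<in> insert v1 Z")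
        case True
        then have "own (Z \<union> Y) v = Y" if "Y \<subseteq> T v" for Y
          using Z that by (auto simp: own_def)
        then have "{Y. Y \<subseteq> T v \<and> Z \<union> Y \<in> bad v} = {Y. Y \<subseteq> T v \<and> real (card Y) < r}"
          by (auto simp: bad_def)
        then show ?thesis using card_small_subsets_le[OF finT[OF v], of r] cardT[OF v]
          by (simp add: p_def)
      next
        case False
        then have "own (Z \<union> Y) v = T v - Y" if "Y \<subseteq> T v" for Y
          using Z that self[OF v] by (auto simp: own_def)
        then have "{Y. Y \<subseteq> T v \<and> Z \<union> Y \<in> bad v} = {Y. Y \<subseteq> T v \<and> real (card (T v - Y)) < r}"
          by (auto simp: bad_def)
        then show ?thesis using card_small_complements_le[OF finT[OF v], of r] cardT[OF v]
          by (simp add: p_def)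
      qed
    qed
    moreover have "Pow W \<inter> bad v - \<Union>(bad ` S) = {X. X \<subseteq> W \<and> ?Q X \<and> X \<in> bad v}"
      "Pow W - \<Union>(bad ` S) = {X. X \<subseteq> W \<and> ?Q X}" by auto
    ultimately show "real (card (Pow W \<inter> bad v - \<Union>(bad ` S)))
        \<le> p * real (card (Pow W - \<Union>(bad ` S)))" by simp
  qed
  then obtain X where "X \<subseteq> W" "\<forall>v\<in>verts G. X \<notin> bad v" by blast
  then have X: "X \<subseteq> W" "\<And>v. v \<in> verts G \<Longrightarrow> r \<le> real (card (own X v))"
    by (auto simp: bad_def not_less)

  define A where "A = insert v1 X"
  define B where "B = verts G - A"
  have AB: "A \<subseteq> verts G" "v1 \<in> A" "v2 \<in> B" "A \<inter> B = {}" "A \<union> B = verts G"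
    using X v12 by (auto simp: A_def B_def W_def)
  then have neq: "A \<noteq> B" by auto
  have friendA: "r \<le> real (card (out_neighbors G v \<inter> A))" if "v \<in> A" for v
  proof -
    have v: "v \<in> verts G" using that AB by auto
    have "own X v \<subseteq> out_neighbors G v \<inter> A" using that T[OF v] by (auto simp: own_def A_def)
    then have "card (own X v) \<le> card (out_neighbors G v \<inter> A)" using finout by (intro card_mono) auto
    then show ?thesis using X(2)[OF v] by linarith
  qed
  have friendB: "r \<le> real (card (out_neighbors G v \<inter> B))" if "v \<in> B" for v
  proof -
    have v: "v \<in> verts G" using that AB by auto
    \<comment> \<open>\<open>T v\<close> avoids \<open>v1\<close>, so its members outside
      \<open>X\<close> are also outside \<open>insert v1 X\<close>.\<close>
    have "own X v \<subseteq> out_neighbors G v \<inter> B"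
      using that T[OF v] by (auto simp: own_def A_def B_def W_def)
    then have "card (own X v) \<le> card (out_neighbors G v \<inter> B)" using finout by (intro card_mono) auto
    then show ?thesis using X(2)[OF v] by linarith
  qed
  have "partition_on (verts G) {A, B}"
    using AB by (auto simp: partition_on_def disjoint_def)
  then have "friendly_partition G r {A, B}"
    using neq friendA friendB by (auto simp: friendly_partition_def)
  moreover have "separates {A, B} v1 v2"
    using AB neq by (auto simp: separates_def)
  ultimately show "\<exists>P. friendly_partition G ((real d - 1) / 4 + 1) P \<and> separates P v1 v2"
    by (auto simp: r_def)
qed

end
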